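(* Let $m\ge1$ be an integer and let $|a_{ij}|_m$ denote the determinant of the $m\times m$ matrix with entries $a_{ij}$, $1\le i,j\le m$. (1) If $a_1,\dots,a_m$ are non-negative integers, then for every $k\in\mathbb{N}$, \[ \Biggl|\frac{S(a_i+a_j+k,k)}{\binom{a_i+a_j+k}{k}}\Biggr|_m\ge0 \quad\text{and}\quad \Biggl|(-1)^{a_i+a_j}\frac{S(a_i+a_j+k,k)}{\binom{a_i+a_j+k}{k}}\Biggr|_m\ge0. \] (2) Let $n\ge1$, let $q=(q_1,\dots,q_n)$ be an $n$-tuple of non-negative integers, and let $a=(a_1,\dots,a_n)$ and $b=(b_1,\dots,b_n)$ be non-increasing $n$-tuples of non-negative integers such that $\sum_{i=1}^{j}q_ia_i\ge\sum_{i=1}^{j}q_ib_i$ for $1\le j\le n-1$ and $\sum_{i=1}^{n}q_ia_i=\sum_{i=1}^{n}q_ib_i$. Then for every $k\in\mathbb{N}$, \[ \prod_{i=1}^n\Biggl[\frac{S(a_i+k,k)}{\binom{a_i+k}{k}}\Biggr]^{q_i}\ge\prod_{i=1}^n\Biggl[\frac{S(b_i+k,k)}{\binom{b_i+k}{k}}\Biggr]^{q_i}. \]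
   Context: $S(n,k)$ denotes the Stirling number of the second kind, i.e. the number of ways to partition an $n$-element set into $k$ nonempty subsets; equivalently $\frac{(e^x-1)^k}{k!}=\sum_{n=k}^\infty S(n,k)\frac{x^n}{n!}$ for integers $k\ge0$. *)

theory Defs
  imports
    "HOL-Combinatorics.Stirling"
    "HOL-Library.Disjoint_Sets"
    "Jordan_Normal_Form.Determinant"
begin

(* The library introduces Stirling by its recurrence.  Stirling_eq_card_partitions shows that
   it counts the partitions of an n-element set into k nonempty blocks. *)

lemma partition_on_insert_cases:
  assumes x: "x \<notin> A" and P: "partition_on (insert x A) P" and fP: "finite P"
    and cP: "card P = Suc k"
  shows "P \<in> insert {x} ` {Q. partition_on A Q \<and> card Q = k} \<union>
    (\<lambda>(Q, B). insert (insert x B) (Q - {B})) ` (SIGMA Q:{Q. partition_on A Q \<and> card Q = Suc k}. Q)"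
proof -
  from P have un: "\<Union>P = insert x A" and ne: "{} \<notin> P"
    and dj: "\<And>p q. p \<in> P \<Longrightarrow> q \<in> P \<Longrightarrow> p \<noteq> q \<Longrightarrow> p \<inter> q = {}"
    by (auto simp: partition_on_def disjoint_def)
  obtain C where C: "C \<in> P" "x \<in> C" using un by blast
  have disj: "disjnt C (\<Union>(P - {C}))" using dj C by (fastforce simp: disjnt_def)
  have PC: "insert C (P - {C}) = P" using C by blast
  have rest: "partition_on (insert x A - C) (P - {C})"
    using partition_on_insert[OF disj, of "insert x A"] P PC by simp
  have cR: "card (P - {C}) = k" using cP C fP by simp
  show ?thesis
  proof (cases "C = {x}")
    case True
    have "insert x A - C = A" using x True by blast
    then have "P - {C} \<in> {Q. partition_on A Q \<and> card Q = k}" using rest cR by simp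
    moreover have "P = insert {x} (P - {C})" using PC True by simp
    ultimately show ?thesis by blast
  next
    case False
    define B where "B = C - {x}"
    define Q where "Q = insert B (P - {C})"
    have B: "B \<noteq> {}" "B \<subseteq> A" "insert x B = C" "x \<notin> B"
      using False C un unfolding B_def by auto
    have BP: "B \<notin> P - {C}"
      using dj[of B C] C B by blast
    have "disjnt B (\<Union>(P - {C}))" using disj unfolding B_def disjnt_def by blast
    moreover have "A - B = insert x A - C" using B x by blast
    ultimately have "partition_on A Q"
      unfolding Q_def using partition_on_insert[of B "P - {C}" A] rest B by simp
    moreover have "card Q = Suc k" unfolding Q_def using BP fP cR by simp
    moreover have "B \<in> Q" unfolding Q_def by simp
    moreover have "P = insert (insert x B) (Q - {B})"
      using BP B PC unfolding Q_def by auto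
    ultimately show ?thesis by (intro UnI2) (auto intro!: image_eqI[where x = "(Q, B)"])
  qed
qed

lemma partition_on_insert_merge:
  assumes x: "x \<notin> A" and Q: "partition_on A Q" and fQ: "finite Q" and B: "B \<in> Q"
  shows "partition_on (insert x A) (insert (insert x B) (Q - {B}))"
    and "card (insert (insert x B) (Q - {B})) = card Q"
proof -
  have un: "\<Union>Q = A" and ne: "{} \<notin> Q"
    and dj: "\<And>p q. p \<in> Q \<Longrightarrow> q \<in> Q \<Longrightarrow> p \<noteq> q \<Longrightarrow> p \<inter> q = {}"
    using Q by (auto simp: partition_on_def disjoint_def)
  have disj: "disjnt B (\<Union>(Q - {B}))" using dj B by (fastforce simp: disjnt_def)
  have BQ: "insert B (Q - {B}) = Q" using B by blast
  have rest: "partition_on (A - B) (Q - {B})"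
    using partition_on_insert[OF disj, of A] Q BQ by simp
  have "disjnt (insert x B) (\<Union>(Q - {B}))" using disj x un by (auto simp: disjnt_def)
  moreover have "insert x A - insert x B = A - B" using x by blast
  moreover have "B \<subseteq> A" using un B by blast
  ultimately show "partition_on (insert x A) (insert (insert x B) (Q - {B}))"
    using partition_on_insert[of "insert x B" "Q - {B}" "insert x A"] rest by auto
  have "insert x B \<notin> Q - {B}" using un x by blast
  then show "card (insert (insert x B) (Q - {B})) = card Q"
    using fQ B by (simp add: card_Suc_Diff1 del: card_Diff_insert card_Diff_singleton)
qed

lemma card_partitions_insert:
  assumes fA: "finite A" and x: "x \<notin> A"
  shows "card {P. partition_on (insert x A) P \<and> card P = Suc k} =
    card {P. partition_on A P \<and> card P = k} + Suc k * card {P. partition_on A P \<and> card P = Suc k}"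
proof -
  let ?S = "\<lambda>k. {Q. partition_on A Q \<and> card Q = k}"
  let ?f = "\<lambda>(Q, B). insert (insert x B) (Q - {B})"
  let ?D = "SIGMA Q:?S (Suc k). Q"
  have finS: "finite (?S k)" for k
    by (rule finite_subset[OF _ finitely_many_partition_on[OF fA]]) auto
  have fin: "finite Q" if "partition_on A Q" for Q using finite_elements[OF fA that] .
  have sub: "\<And>Q B y. partition_on A Q \<Longrightarrow> B \<in> Q \<Longrightarrow> y \<in> B \<Longrightarrow> y \<in> A"
    by (auto simp: partition_on_def)
  have nx: "x \<notin> B" if "partition_on A Q" "B \<in> Q" for Q B using sub[OF that] x by blast
  have eq: "{P. partition_on (insert x A) P \<and> card P = Suc k} = insert {x} ` ?S k \<union> ?f ` ?D"
    (is "?L = ?R")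
  proof
    show "?L \<subseteq> ?R"
    proof
      fix P assume "P \<in> ?L"
      then have "partition_on (insert x A) P" "card P = Suc k" by auto
      then show "P \<in> ?R"
        using partition_on_insert_cases[OF x, of P k] finite_elements[of "insert x A" P] fA
        by blast
    qed
  next
    show "?R \<subseteq> ?L"
    proof
      fix P assume "P \<in> ?R"
      then consider Q where "partition_on A Q" "card Q = k" "P = insert {x} Q"
        | Q B where "partition_on A Q" "card Q = Suc k" "B \<in> Q" "P = ?f (Q, B)" by auto
      then show "P \<in> ?L"
      proof cases
        case (1 Q)
        have "disjnt {x} (\<Union>Q)" using nx[OF 1(1)] by auto
        then have "partition_on (insert x A) P"
          using partition_on_insert[of "{x}" Q "insert x A"] 1 x by simp
        moreover have "{x} \<notin> Q" using nx[OF 1(1)] by blast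
        ultimately show ?thesis using 1 fin by simp
      next
        case (2 Q B)
        then show ?thesis using partition_on_insert_merge[OF x 2(1) fin[OF 2(1)] 2(3)] by simp
      qed
    qed
  qed
  have inj1: "inj_on (insert {x}) (?S k)"
  proof (rule inj_onI)
    fix P Q assume "P \<in> ?S k" "Q \<in> ?S k" "insert {x} P = insert {x} Q"
    moreover from this have "{x} \<notin> P" "{x} \<notin> Q" using nx by blast+
    ultimately show "P = Q" by (metis insert_ident)
  qed
  have inj2: "inj_on ?f ?D"
  proof (rule inj_onI)
    fix u v assume u: "u \<in> ?D" and v: "v \<in> ?D" and e: "?f u = ?f v"
    obtain P B Q C where uv: "u = (P, B)" "v = (Q, C)" by (cases u, cases v)
    have P: "partition_on A P" "B \<in> P" and Q: "partition_on A Q" "C \<in> Q"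
      using u v uv by auto
    have xB: "insert x B \<notin> P - {B}" "insert x C \<notin> Q - {C}" "x \<notin> B" "x \<notin> C"
      using nx[OF P(1)] nx[OF Q(1)] P Q by blast+
    have e': "insert (insert x B) (P - {B}) = insert (insert x C) (Q - {C})" using e uv by simp
    have "insert x B \<notin> Q - {C}" using nx[OF Q(1)] by blast
    then have BC: "insert x B = insert x C" using e' by blast
    then have "B = C" using xB by (metis insert_ident)
    moreover have "P - {B} = Q - {C}" using e' BC xB by (metis insert_ident)
    ultimately show "u = v" using P Q uv by blast
  qed
  have dis: "insert {x} ` ?S k \<inter> ?f ` ?D = {}"
  proof (rule ccontr)
    assume "insert {x} ` ?S k \<inter> ?f ` ?D \<noteq> {}"
    then obtain P Q B where h: "partition_on A Q" "B \<in> Q"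
      "insert {x} P = insert (insert x B) (Q - {B})" by auto
    have "{x} \<in> insert (insert x B) (Q - {B})" using h(3) by blast
    moreover have "{x} \<notin> Q" using nx[OF h(1)] by blast
    ultimately have "insert x B = {x}" by blast
    then have "B = {}" using nx[OF h(1,2)] by blast
    then show False using h by (simp add: partition_on_def)
  qed
  have cD: "card ?D = Suc k * card (?S (Suc k))"
  proof -
    have "card ?D = (\<Sum>Q\<in>?S (Suc k). card Q)"
      using finS fin by (intro card_SigmaI) auto
    also have "\<dots> = (\<Sum>Q\<in>?S (Suc k). Suc k)" by (rule sum.cong) auto
    finally show ?thesis by simp
  qed
  have finD: "finite ?D" using finS fin by (intro finite_SigmaI) auto
  have "card (insert {x} ` ?S k \<union> ?f ` ?D) = card (insert {x} ` ?S k) + card (?f ` ?D)"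
    using finS finD dis by (intro card_Un_disjoint) auto
  then show ?thesis
    unfolding eq card_image[OF inj1] card_image[OF inj2] cD .
qed

theorem Stirling_eq_card_partitions:
  assumes "finite A"
  shows "Stirling (card A) k = card {P. partition_on A P \<and> card P = k}"
  using assms
proof (induction A arbitrary: k rule: finite_induct)
  case empty
  have "{P. partition_on ({} :: 'a set) P \<and> card P = k} = (if k = 0 then {{}} else {})"
    by (auto simp: partition_on_empty)
  then show ?case by (cases k) (simp_all only: card.empty, simp_all)
next
  case (insert x A)
  show ?case
  proof (cases k)
    case 0
    have "card P \<noteq> 0" if P: "partition_on (insert x A) P" for P
    proof -
      have "P \<noteq> {}" using partition_onD1[OF P] by auto
      then show ?thesis using finite_elements[OF _ P] insert.hyps by simp
    qed
    then have "{P. partition_on (insert x A) P \<and> card P = 0} = {}" by blast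
    then show ?thesis unfolding 0 using insert.hyps by (simp only: card.empty) simp
  next
    case (Suc j)
    show ?thesis
      unfolding Suc card_partitions_insert[OF insert.hyps] insert.IH[symmetric]
      using insert.hyps by simp
  qed
qed

end

theory Submission
  imports Defs "Jordan_Normal_Form.Char_Poly"
begin

text \<open>The ratio \<open>f k n = S(n+k,k) / ((n+k) choose k)\<close> is \<open>n!\<close> times the coefficient of \<open>x^n\<close> in
  \<open>((exp x - 1)/x)^k\<close>, i.e. the \<open>n\<close>-th moment of a sum of \<open>k\<close> independent uniform variables on
  \<open>[0,1]\<close>. Hence the linear functional \<open>x^n \<mapsto> f k n\<close> is non-negative on polynomials that are
  non-negative on \<open>[0,\<infinity>)\<close>. Squares of polynomials give positive semidefinite Hankel-type matrices and
  thus (1); the polynomials \<open>x^n (s + t x)^2\<close> give log-convexity of \<open>f k\<close>, and (2) is then the weighted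
  majorization inequality for a convex sequence.\<close>

definition stirling_ratio :: "nat \<Rightarrow> nat \<Rightarrow> real" where
  "stirling_ratio k n = real (Stirling (n + k) k) / real ((n + k) choose k)"

section \<open>The averaging recurrence\<close>

text \<open>In a partition of \<open>N + 1\<close> points into \<open>k + 1\<close> blocks, let
  \<open>i\<close> count the points outside the block of one fixed point: they form one of
  \<open>N choose i\<close> sets, split into \<open>k\<close> blocks. The formal proof is by
  Pascal's rule; \<open>k\<close> is generalized because the Stirling recurrence lowers it.\<close>

lemma sum_binomial_Stirling:
  "(\<Sum>i\<le>N. (N choose i) * Stirling i k) = Stirling (Suc N) (Suc k)"
proof (induction N arbitrary: k)
  case 0
  show ?case by (cases k) auto
next
  case (Suc N)
  have "(\<Sum>i\<le>Suc N. (Suc N choose i) * Stirling i k)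
      = Stirling 0 k + (\<Sum>i\<le>N. (Suc N choose Suc i) * Stirling (Suc i) k)"
    by (subst sum.atMost_Suc_shift) simp
  also have "\<dots> = (Stirling 0 k + (\<Sum>i\<le>N. (N choose Suc i) * Stirling (Suc i) k))
      + (\<Sum>i\<le>N. (N choose i) * Stirling (Suc i) k)"
    by (simp add: algebra_simps sum.distrib)
  also have "Stirling 0 k + (\<Sum>i\<le>N. (N choose Suc i) * Stirling (Suc i) k)
      = (\<Sum>i\<le>Suc N. (N choose i) * Stirling i k)"
    by (subst sum.atMost_Suc_shift) simp
  also have "\<dots> = (\<Sum>i\<le>N. (N choose i) * Stirling i k)"
    by simp
  also have "\<dots> = Stirling (Suc N) (Suc k)"
    by (rule Suc.IH)
  also have "(\<Sum>i\<le>N. (N choose i) * Stirling (Suc i) k) = k * Stirling (Suc N) (Suc k) + Stirling (Suc N) k"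
  proof (cases k)
    case 0
    then show ?thesis by simp
  next
    case k: (Suc l)
    have "(\<Sum>i\<le>N. (N choose i) * Stirling (Suc i) k)
        = k * (\<Sum>i\<le>N. (N choose i) * Stirling i k) + (\<Sum>i\<le>N. (N choose i) * Stirling i l)"
      unfolding k by (simp add: algebra_simps sum.distrib sum_distrib_left)
    then show ?thesis
      by (simp only: Suc.IH k)
  qed
  finally show ?case by simp
qed

text \<open>The omitted term \<open>i = N\<close> is \<open>Stirling N k\<close>, which is also the
  second summand in the recurrence for \<open>Stirling (Suc N) (Suc k)\<close>.\<close>

lemma sum_lessThan_binomial_Stirling:
  "(\<Sum>i<N. (N choose i) * Stirling i k) = Suc k * Stirling N (Suc k)"
  using sum_binomial_Stirling[of N k]
  by (simp add: lessThan_Suc_atMost[symmetric])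

lemma stirling_ratio_fact:
  "stirling_ratio k n = real (Stirling (n + k) k) * fact k * fact n / fact (n + k)"
  unfolding stirling_ratio_def by (subst binomial_fact) (simp_all add: field_simps)

text \<open>Prepares the recurrence below: the factorial prefactor on the right is free of
  \<open>j\<close>, so summing over \<open>j\<close> leaves a binomial sum of Stirling numbers with
  index \<open>j + k\<close>.\<close>

lemma binomial_mult_stirling_ratio:
  assumes "j \<le> n"
  shows "real (Suc n choose j) / real (Suc n) * stirling_ratio k j
    = fact n * fact k / fact (n + Suc k) * real ((n + Suc k) choose (j + k)) * real (Stirling (j + k) k)"
proof -
  have A: "real (Suc n choose j) = fact (Suc n) / (fact j * fact (Suc n - j))"
    using assms by (intro binomial_fact) simp
  have B: "real ((n + Suc k) choose (j + k)) = fact (n + Suc k) / (fact (j + k) * fact (Suc n - j))"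
    using assms by (subst binomial_fact) (simp_all add: Suc_diff_le)
  have C: "fact (Suc n) = real (Suc n) * fact n"
    by (rule fact_Suc)
  have pos: "fact j \<noteq> (0::real)" "fact (Suc n - j) \<noteq> (0::real)" "fact (j + k) \<noteq> (0::real)"
    "fact (n + Suc k) \<noteq> (0::real)" "real (Suc n) \<noteq> 0"
    using fact_nonzero by (blast, blast, blast, blast, simp)
  show ?thesis
    unfolding A B C stirling_ratio_fact using pos
    by (simp del: fact_Suc of_nat_Suc add: divide_simps)
qed

text \<open>This is the moment recurrence for adding an independent uniform variable on [0,1], whose
  \<open>(n - j)\<close>-th moment is \<open>1 / (n - j + 1)\<close>: the weight
  \<open>(n choose j) / (n - j + 1)\<close> equals \<open>(Suc n choose j) / Suc n\<close>.\<close>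

lemma stirling_ratio_Suc:
  "stirling_ratio (Suc k) n = (\<Sum>j\<le>n. real (Suc n choose j) / real (Suc n) * stirling_ratio k j)"
proof -
  let ?N = "n + Suc k"
  have "(\<Sum>j\<le>n. real (Suc n choose j) / real (Suc n) * stirling_ratio k j)
      = fact n * fact k / fact ?N * real (\<Sum>j\<le>n. (?N choose (j + k)) * Stirling (j + k) k)"
    unfolding of_nat_sum sum_distrib_left
    by (intro sum.cong refl) (simp only: atMost_iff binomial_mult_stirling_ratio of_nat_mult mult.assoc)
  also have "(\<Sum>j\<le>n. (?N choose (j + k)) * Stirling (j + k) k)
      = (\<Sum>i\<in>{k..n + k}. (?N choose i) * Stirling i k)"
    by (rule sum.reindex_bij_witness[where i = "\<lambda>i. i - k" and j = "\<lambda>j. j + k"]) auto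
  \<comment> \<open>The added indices \<open>i < k\<close> contribute nothing, since
    \<open>Stirling i k = 0\<close> there.\<close>
  also have "\<dots> = (\<Sum>i<?N. (?N choose i) * Stirling i k)"
    by (intro sum.mono_neutral_left) auto
  also have "\<dots> = Suc k * Stirling ?N (Suc k)"
    by (rule sum_lessThan_binomial_Stirling)
  also have "fact n * fact k / fact ?N * real (Suc k * Stirling ?N (Suc k)) = stirling_ratio (Suc k) n"
    unfolding stirling_ratio_fact fact_Suc[of k] of_nat_mult
    by (simp only: times_divide_eq_left times_divide_eq_right mult_ac)
  finally show ?thesis ..
qed

section \<open>Positivity of the moment functional\<close>

text \<open>Averaging \<open>x^n\<close> over \<open>[x, x+1]\<close>; by the recurrence this sends the functional for \<open>k\<close> to that
  for \<open>k+1\<close>.\<close>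

lemma sum_binomial_power_eq_difference:
  fixes x :: real
  shows "(\<Sum>j\<le>n. real (Suc n choose j) / real (Suc n) * x ^ j) = ((x + 1) ^ Suc n - x ^ Suc n) / real (Suc n)"
proof -
  have "(x + 1) ^ Suc n = (\<Sum>j\<le>Suc n. real (Suc n choose j) * x ^ j)"
    by (subst binomial_ring) simp
  then have "(x + 1) ^ Suc n - x ^ Suc n = (\<Sum>j\<le>n. real (Suc n choose j) * x ^ j)"
    by simp
  then show ?thesis
    by (simp only: sum_divide_distrib times_divide_eq_left)
qed

text \<open>The sum is the integral of the polynomial over \<open>[x, x + 1]\<close>. With the
  antiderivative \<open>P\<close>, the mean value theorem turns it into a value of the polynomial at
  some \<open>z > x\<close>.\<close>

lemma average_nonneg:
  fixes c :: "nat \<Rightarrow> real"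
  assumes nonneg: "\<And>x. x \<ge> 0 \<Longrightarrow> (\<Sum>n\<le>N. c n * x ^ n) \<ge> 0" and "x \<ge> 0"
  shows "(\<Sum>n\<le>N. c n * (((x + 1) ^ Suc n - x ^ Suc n) / real (Suc n))) \<ge> 0"
proof -
  define P where "P = (\<lambda>x. \<Sum>n\<le>N. c n / real (Suc n) * x ^ Suc n)"
  have "(P has_real_derivative (\<Sum>n\<le>N. c n * y ^ n)) (at y)" for y
  proof -
    have "(P has_real_derivative (\<Sum>n\<le>N. c n / real (Suc n) * (real (Suc n) * y ^ n))) (at y)"
      unfolding P_def by (rule DERIV_sum, rule DERIV_cmult, rule derivative_eq_intros) (rule derivative_eq_intros | simp)+
    then show ?thesis by (simp del: of_nat_Suc)
  qed
  from MVT2[of x "x + 1" P, OF _ this] obtain z where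
    z: "x < z" "P (x + 1) - P x = (\<Sum>n\<le>N. c n * z ^ n)" by auto
  have "P (x + 1) - P x = (\<Sum>n\<le>N. c n * (((x + 1) ^ Suc n - x ^ Suc n) / real (Suc n)))"
    unfolding P_def sum_subtractf[symmetric]
    by (intro sum.cong refl) (simp only: times_divide_eq_left times_divide_eq_right diff_divide_distrib right_diff_distrib)
  then show ?thesis
    using z nonneg[of z] \<open>x \<ge> 0\<close> by simp
qed

text \<open>Induction on \<open>k\<close> for all coefficients at once. For \<open>k = 0\<close> the
  functional is evaluation at 0; in the step, the recurrence moves onto the coefficients, where it
  averages the polynomial and so keeps it non-negative on the half-line.\<close>

lemma moment_functional_nonneg_atMost:
  fixes c :: "nat \<Rightarrow> real"
  assumes "\<And>x. x \<ge> 0 \<Longrightarrow> (\<Sum>n\<le>N. c n * x ^ n) \<ge> 0"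
  shows "(\<Sum>n\<le>N. c n * stirling_ratio k n) \<ge> 0"
  using assms
proof (induction k arbitrary: c)
  case 0
  have "(\<Sum>n\<le>N. c n * stirling_ratio 0 n) = (\<Sum>n\<le>N. c n * 0 ^ n)"
  proof (intro sum.cong refl)
    fix n show "c n * stirling_ratio 0 n = c n * 0 ^ n"
      by (cases n) (simp_all add: stirling_ratio_def)
  qed
  then show ?case
    using "0.prems"[of 0] by simp
next
  case (Suc k)
  \<comment> \<open>Extending the weights by 0 makes both sums range up to \<open>N\<close>, so that
    they can be swapped.\<close>
  define w where "w n j = (if j \<le> n then real (Suc n choose j) / real (Suc n) else 0)" for n j
  have w: "(\<Sum>j\<le>N. w n j * g j) = (\<Sum>j\<le>n. real (Suc n choose j) / real (Suc n) * g j)"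
    if "n \<le> N" for n and g :: "nat \<Rightarrow> real"
    using that by (intro sum.mono_neutral_cong_right) (auto simp: w_def)
  have swap: "(\<Sum>n\<le>N. c n * (\<Sum>j\<le>n. real (Suc n choose j) / real (Suc n) * g j))
      = (\<Sum>j\<le>N. (\<Sum>n\<le>N. c n * w n j) * g j)" for g :: "nat \<Rightarrow> real"
  proof -
    have "(\<Sum>n\<le>N. c n * (\<Sum>j\<le>n. real (Suc n choose j) / real (Suc n) * g j))
        = (\<Sum>n\<le>N. \<Sum>j\<le>N. c n * w n j * g j)"
      by (intro sum.cong refl) (simp only: atMost_iff w[symmetric] sum_distrib_left mult.assoc)
    also have "\<dots> = (\<Sum>j\<le>N. (\<Sum>n\<le>N. c n * w n j) * g j)"
      by (subst sum.swap) (simp add: sum_distrib_right)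
    finally show ?thesis .
  qed
  have "(\<Sum>j\<le>N. (\<Sum>n\<le>N. c n * w n j) * x ^ j) \<ge> 0" if "x \<ge> 0" for x
    using average_nonneg[OF Suc.prems that]
    unfolding swap[symmetric] sum_binomial_power_eq_difference .
  from Suc.IH[OF this] show ?case
    unfolding swap[symmetric] stirling_ratio_Suc .
qed

text \<open>Collecting terms with equal exponents reduces this to the previous lemma; repeated
  exponents arise when squares are expanded.\<close>

lemma moment_functional_nonneg:
  fixes c :: "'i \<Rightarrow> real" and e :: "'i \<Rightarrow> nat"
  assumes fin: "finite I" and nonneg: "\<And>x. x \<ge> 0 \<Longrightarrow> (\<Sum>i\<in>I. c i * x ^ e i) \<ge> 0"
  shows "(\<Sum>i\<in>I. c i * stirling_ratio k (e i)) \<ge> 0"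
proof -
  define N where "N = Max (insert 0 (e ` I))"
  have N: "e ` I \<subseteq> {..N}"
    using fin unfolding N_def by auto
  have group: "(\<Sum>i\<in>I. c i * g (e i)) = (\<Sum>n\<le>N. (\<Sum>i | i \<in> I \<and> e i = n. c i) * g n)" for g
  proof -
    have "(\<Sum>n\<le>N. (\<Sum>i | i \<in> I \<and> e i = n. c i) * g n)
        = (\<Sum>n\<le>N. \<Sum>i | i \<in> I \<and> e i = n. c i * g (e i))"
      by (intro sum.cong refl) (auto simp: sum_distrib_right intro!: sum.cong)
    also have "\<dots> = (\<Sum>i\<in>I. c i * g (e i))"
      using fin N by (intro sum.group) auto
    finally show ?thesis ..
  qed
  show ?thesis
    unfolding group using nonneg unfolding group by (rule moment_functional_nonneg_atMost)
qed

text \<open>The form is the functional applied to the square of the polynomial with terms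
  \<open>y i * x ^ a i\<close>.\<close>

lemma stirling_ratio_quadratic_form_nonneg:
  fixes y :: "'i \<Rightarrow> real" and a :: "'i \<Rightarrow> nat"
  assumes "finite I"
  shows "(\<Sum>i\<in>I. \<Sum>j\<in>I. y i * y j * stirling_ratio k (a i + a j)) \<ge> 0"
proof -
  have "(\<Sum>p\<in>I \<times> I. y (fst p) * y (snd p) * x ^ (a (fst p) + a (snd p))) \<ge> 0" for x
  proof -
    have "(\<Sum>p\<in>I \<times> I. y (fst p) * y (snd p) * x ^ (a (fst p) + a (snd p)))
        = (\<Sum>i\<in>I. y i * x ^ a i) * (\<Sum>i\<in>I. y i * x ^ a i)"
      unfolding sum_product sum.cartesian_product by (intro sum.cong) (auto simp: power_add)
    then show ?thesis by simp
  qed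
  with assms have "(\<Sum>p\<in>I \<times> I. y (fst p) * y (snd p) * stirling_ratio k (a (fst p) + a (snd p))) \<ge> 0"
    by (intro moment_functional_nonneg) auto
  then show ?thesis
    by (simp add: sum.cartesian_product split_def)
qed

section \<open>Determinants\<close>

text \<open>The monic polynomial \<open>t \<mapsto> det (t I + A)\<close> has no positive root, so its value at \<open>0\<close> is
  non-negative.\<close>

lemma det_nonneg_if_quadratic_form_nonneg:
  fixes A :: "real mat"
  assumes A: "A \<in> carrier_mat n n"
    and nonneg: "\<And>v. v \<in> carrier_vec n \<Longrightarrow> v \<bullet> (A *\<^sub>v v) \<ge> 0"
  shows "det A \<ge> 0"
proof (rule ccontr)
  assume neg: "\<not> det A \<ge> 0"
  let ?p = "char_poly (- A)"
  have A': "- A \<in> carrier_mat n n"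
    using A by simp
  \<comment> \<open>Hence \<open>poly ?p 0 = det A\<close>.\<close>
  have "- char_matrix (- A) 0 = A"
    using A by (intro eq_matI) (auto simp: char_matrix_def)
  then have "poly ?p 0 < 0"
    using char_poly_matrix[OF A', of 0] neg by simp
  have "lead_coeff ?p > 0"
    using degree_monic_char_poly[OF A'] by simp
  from poly_pinfty_gt_lc[OF this] obtain M where M: "\<And>x. x \<ge> M \<Longrightarrow> poly ?p x \<ge> lead_coeff ?p"
    by blast
  have "poly ?p (max M 1) > 0"
    using M[of "max M 1"] \<open>lead_coeff ?p > 0\<close> by linarith
  moreover have "(0::real) < max M 1"
    by simp
  ultimately obtain t where t: "t > 0" "poly ?p t = 0"
    using poly_IVT_pos[of 0 "max M 1" ?p] \<open>poly ?p 0 < 0\<close> by blast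
  \<comment> \<open>A positive root \<open>t\<close> is an eigenvalue of \<open>- A\<close>; on its
    eigenvector the form equals \<open>- t * (v \<bullet> v) < 0\<close>.\<close>
  then obtain v where v: "v \<in> carrier_vec n" "v \<noteq> 0\<^sub>v n" "(- A) *\<^sub>v v = t \<cdot>\<^sub>v v"
    using eigenvalue_root_char_poly[OF A', of t] A by (auto simp: eigenvalue_def eigenvector_def)
  have "A *\<^sub>v v = - ((- A) *\<^sub>v v)"
    using A v(1) by (intro eq_vecI) auto
  then have "v \<bullet> (A *\<^sub>v v) = - (t * (v \<bullet> v))"
    using v by simp
  moreover have "v \<bullet> v > 0"
    using conjugate_square_greater_0_vec[OF v(1)] v(2) by simp
  ultimately show False
    using nonneg[OF v(1)] mult_pos_pos[OF t(1), of "v \<bullet> v"] by linarith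
qed

text \<open>The factors \<open>s\<close> are absorbed into the test vector. Taking \<open>s\<close>
  to be 1 or the sign \<open>(-1) ^ a i\<close> yields the two determinants of part (1).\<close>

lemma det_stirling_ratio_nonneg:
  fixes a :: "nat \<Rightarrow> nat" and s :: "nat \<Rightarrow> real"
  shows "det (mat m m (\<lambda>(i, j). s i * s j * stirling_ratio k (a i + a j))) \<ge> 0"
proof (rule det_nonneg_if_quadratic_form_nonneg)
  fix v :: "real vec" assume v: "v \<in> carrier_vec m"
  have "v \<bullet> (mat m m (\<lambda>(i, j). s i * s j * stirling_ratio k (a i + a j)) *\<^sub>v v)
      = (\<Sum>i\<in>{0..<m}. \<Sum>j\<in>{0..<m}. (s i * v $ i) * (s j * v $ j) * stirling_ratio k (a i + a j))"
    using v by (auto simp: scalar_prod_def sum_distrib_left algebra_simps intro!: sum.cong)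
  also have "\<dots> \<ge> 0"
    by (rule stirling_ratio_quadratic_form_nonneg) simp
  finally show "v \<bullet> (mat m m (\<lambda>(i, j). s i * s j * stirling_ratio k (a i + a j)) *\<^sub>v v) \<ge> 0" .
qed simp

section \<open>Log-convexity and majorization\<close>

lemma stirling_ratio_pos:
  assumes "k > 0"
  shows "stirling_ratio k n > 0"
proof -
  have "Stirling (n + k) k > 0" using assms
  proof (induction n)
    case (Suc n)
    then show ?case by (cases k) auto
  qed simp
  then show ?thesis
    by (simp add: stirling_ratio_def)
qed

lemma stirling_ratio_log_convex:
  assumes "k > 0"
  shows "stirling_ratio k (Suc n) ^ 2 \<le> stirling_ratio k n * stirling_ratio k (Suc (Suc n))"
proof -
  let ?f = "stirling_ratio k"
  \<comment> \<open>For \<open>t = - ?f n\<close>, this \<open>s\<close> minimizes the functional on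
    \<open>x ^ n * (s + t * x) ^ 2\<close>; the minimum is \<open>?f n\<close> times the
    log-convexity gap.\<close>
  define s t where "s = ?f (Suc n)" and "t = - ?f n"
  define c :: "nat \<Rightarrow> real" where "c i = (if i = 0 then s^2 else if i = 1 then 2 * s * t else t^2)" for i
  have "(\<Sum>i\<in>{0, 1, 2}. c i * x ^ (n + i)) \<ge> 0" if "x \<ge> 0" for x
  proof -
    have "(\<Sum>i\<in>{0, 1, 2}. c i * x ^ (n + i)) = x ^ n * (s + t * x) ^ 2"
      by (simp add: c_def power_add power2_eq_square algebra_simps)
    then show ?thesis
      using that by simp
  qed
  then have "(\<Sum>i\<in>{0, 1, 2}. c i * ?f (n + i)) \<ge> 0"
    by (intro moment_functional_nonneg) auto
  also have "(\<Sum>i\<in>{0, 1, 2}. c i * ?f (n + i)) = ?f n * (?f n * ?f (Suc (Suc n)) - ?f (Suc n) ^ 2)"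
    by (simp add: c_def s_def t_def power2_eq_square algebra_simps)
  finally show ?thesis
    using stirling_ratio_pos[OF assms, of n] by (simp add: zero_le_mult_iff)
qed

text \<open>Telescoping: increments to the right of \<open>y\<close> are at least the slope at
  \<open>y\<close>, those to the left at most that slope.\<close>

lemma mono_diff_imp_supporting_line:
  fixes g :: "nat \<Rightarrow> real"
  assumes mono: "mono (\<lambda>n. g (Suc n) - g n)"
  shows "g x - g y \<ge> (g (Suc y) - g y) * (real x - real y)"
proof (cases "y \<le> x")
  case True
  then show ?thesis
  proof (induction rule: dec_induct)
    case (step z)
    then show ?case
      using monoD[OF mono, of y z] by (simp add: algebra_simps)
  qed simp
next
  case False
  then have "x \<le> y" by simp
  then show ?thesis
  proof (induction rule: inc_induct)
    case (step z)
    then show ?case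
      using monoD[OF mono, of z y] by (simp add: algebra_simps)
  qed simp
qed

text \<open>Abel summation, carried out by induction: lowering the factor of a non-negative partial
  sum from \<open>c n\<close> to \<open>c (Suc n)\<close> can only decrease it.\<close>

lemma sum_antimono_mult_nonneg:
  fixes c d :: "nat \<Rightarrow> real"
  assumes "n \<ge> 1" "antimono_on {1..n} c"
    and "\<And>j. j \<in> {1..n - 1} \<Longrightarrow> (\<Sum>i=1..j. d i) \<ge> 0"
  shows "(\<Sum>i=1..n. c i * d i) \<ge> c n * (\<Sum>i=1..n. d i)"
  using assms
proof (induction n rule: nat_induct_at_least)
  case (Suc n)
  have "antimono_on {1..n} c"
    using Suc.prems(1) by (auto simp: monotone_on_def)
  then have "(\<Sum>i=1..n. c i * d i) \<ge> c n * (\<Sum>i=1..n. d i)"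
    using Suc.prems(2) by (intro Suc.IH) auto
  moreover have "c n * (\<Sum>i=1..n. d i) \<ge> c (Suc n) * (\<Sum>i=1..n. d i)"
    using Suc.prems Suc.hyps by (intro mult_right_mono) (auto simp: monotone_on_def)
  ultimately show ?case
    by (simp add: algebra_simps)
qed simp

text \<open>Each \<open>g (a i)\<close> is bounded below by the supporting line at
  \<open>b i\<close>. The slopes \<open>c i\<close> are non-increasing because \<open>b\<close> is,
  so Abel summation bounds the weighted linear terms below by \<open>c n\<close> times their total
  \<open>d\<close>, which is 0.\<close>

lemma weighted_majorization:
  fixes g :: "nat \<Rightarrow> real" and q a b :: "nat \<Rightarrow> nat"
  assumes mono: "mono (\<lambda>n. g (Suc n) - g n)" and "n \<ge> 1" and b: "antimono_on {1..n} b"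
    and le: "\<forall>j\<in>{1..n - 1}. (\<Sum>i=1..j. q i * a i) \<ge> (\<Sum>i=1..j. q i * b i)"
    and eq: "(\<Sum>i=1..n. q i * a i) = (\<Sum>i=1..n. q i * b i)"
  shows "(\<Sum>i=1..n. real (q i) * g (a i)) \<ge> (\<Sum>i=1..n. real (q i) * g (b i))"
proof -
  define c where "c i = g (Suc (b i)) - g (b i)" for i
  define d where "d i = real (q i) * (real (a i) - real (b i))" for i
  have d: "(\<Sum>i=1..j. d i) = real (\<Sum>i=1..j. q i * a i) - real (\<Sum>i=1..j. q i * b i)" for j
    by (simp add: d_def sum_subtractf right_diff_distrib)
  have "antimono_on {1..n} c"
    using b monoD[OF mono] by (auto simp: monotone_on_def c_def)
  then have "(\<Sum>i=1..n. c i * d i) \<ge> c n * (\<Sum>i=1..n. d i)"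
  proof (intro sum_antimono_mult_nonneg \<open>n \<ge> 1\<close>)
    fix j assume "j \<in> {1..n - 1}"
    with le show "(\<Sum>i=1..j. d i) \<ge> 0"
      unfolding d by (simp del: of_nat_sum)
  qed
  also have "(\<Sum>i=1..n. d i) = 0"
    using eq unfolding d by simp
  finally have "0 \<le> (\<Sum>i=1..n. c i * d i)" by simp
  also have "\<dots> \<le> (\<Sum>i=1..n. real (q i) * g (a i) - real (q i) * g (b i))"
  proof (intro sum_mono)
    fix i
    have "real (q i) * (c i * (real (a i) - real (b i))) \<le> real (q i) * (g (a i) - g (b i))"
      unfolding c_def by (intro mult_left_mono mono_diff_imp_supporting_line mono) simp
    then show "c i * d i \<le> real (q i) * g (a i) - real (q i) * g (b i)"
      by (simp add: d_def algebra_simps)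
  qed
  finally show ?thesis
    by (simp add: sum_subtractf)
qed

lemma mono_diff_ln_stirling_ratio:
  assumes "k > 0"
  shows "mono (\<lambda>n. ln (stirling_ratio k (Suc n)) - ln (stirling_ratio k n))"
proof (rule mono_iff_le_Suc[THEN iffD2], rule allI)
  fix n
  let ?f = "stirling_ratio k"
  have pos: "?f n > 0" "?f (Suc n) > 0" "?f (Suc (Suc n)) > 0"
    using assms by (simp_all add: stirling_ratio_pos)
  have "ln (?f (Suc n) ^ 2) \<le> ln (?f n * ?f (Suc (Suc n)))"
    using stirling_ratio_log_convex[OF assms, of n] pos by (subst ln_le_cancel_iff) auto
  then show "ln (?f (Suc n)) - ln (?f n) \<le> ln (?f (Suc (Suc n))) - ln (?f (Suc n))"
    using pos by (simp add: ln_realpow ln_mult)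
qed

lemma prod_stirling_ratio_majorization:
  fixes q a b :: "nat \<Rightarrow> nat"
  assumes "n \<ge> 1" "antimono_on {1..n} b"
    and "\<forall>j\<in>{1..n - 1}. (\<Sum>i=1..j. q i * a i) \<ge> (\<Sum>i=1..j. q i * b i)"
    and eq: "(\<Sum>i=1..n. q i * a i) = (\<Sum>i=1..n. q i * b i)"
  shows "(\<Prod>i=1..n. stirling_ratio k (a i) ^ q i) \<ge> (\<Prod>i=1..n. stirling_ratio k (b i) ^ q i)"
proof (cases "k = 0")
  case True
  have f: "stirling_ratio 0 x ^ r = (if r * x = 0 then 1 else 0)" for x r
    by (cases x) (simp_all add: stirling_ratio_def)
  show ?thesis
  proof (cases "\<forall>i\<in>{1..n}. q i * b i = 0")
    case True
    then have "\<forall>i\<in>{1..n}. q i * a i = 0"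
      using eq by (metis (no_types, lifting) finite_atLeastAtMost sum.neutral sum_eq_0_iff)
    with True show ?thesis
      unfolding \<open>k = 0\<close> f by simp
  next
    case False
    then have "(\<Prod>i=1..n. stirling_ratio k (b i) ^ q i) = 0"
      unfolding \<open>k = 0\<close> f by (auto intro!: prod_zero)
    moreover have "(\<Prod>i=1..n. stirling_ratio k (a i) ^ q i) \<ge> 0"
      by (intro prod_nonneg) (simp add: stirling_ratio_def)
    ultimately show ?thesis
      by (simp only:)
  qed
next
  case False
  have pos: "stirling_ratio k x > 0" for x
    using False by (simp add: stirling_ratio_pos)
  have exp: "(\<Prod>i=1..n. stirling_ratio k (x i) ^ q i)
      = exp (\<Sum>i=1..n. real (q i) * ln (stirling_ratio k (x i)))" for x :: "nat \<Rightarrow> nat"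
    using pos by (simp add: exp_sum exp_of_nat_mult)
  show ?thesis
    unfolding exp exp_le_cancel_iff using False assms
    by (intro weighted_majorization mono_diff_ln_stirling_ratio) auto
qed

theorem theorem3p1:
  shows
    "(\<forall>(m::nat) (a::nat \<Rightarrow> nat) (k::nat). m \<ge> 1 \<longrightarrow>
        det (mat m m (\<lambda>(i, j). real (Stirling (a (i + 1) + a (j + 1) + k) k)
                             / real ((a (i + 1) + a (j + 1) + k) choose k))) \<ge> 0
      \<and> det (mat m m (\<lambda>(i, j). (- 1) ^ (a (i + 1) + a (j + 1))
                             * (real (Stirling (a (i + 1) + a (j + 1) + k) k)
                                / real ((a (i + 1) + a (j + 1) + k) choose k)))) \<ge> 0)
   \<and> (\<forall>(n::nat) (q::nat \<Rightarrow> nat) (a::nat \<Rightarrow> nat) (b::nat \<Rightarrow> nat). n \<ge> 1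
        \<longrightarrow> antimono_on {1..n} a \<longrightarrow> antimono_on {1..n} b
        \<longrightarrow> (\<forall>j\<in>{1..n - 1}. (\<Sum>i=1..j. q i * a i) \<ge> (\<Sum>i=1..j. q i * b i))
        \<longrightarrow> (\<Sum>i=1..n. q i * a i) = (\<Sum>i=1..n. q i * b i)
        \<longrightarrow> (\<forall>k::nat.
              (\<Prod>i=1..n. (real (Stirling (a i + k) k) / real ((a i + k) choose k)) ^ q i)
            \<ge> (\<Prod>i=1..n. (real (Stirling (b i + k) k) / real ((b i + k) choose k)) ^ q i)))"
  unfolding stirling_ratio_def[symmetric]
proof (intro conjI allI impI)
  fix m k :: nat and a :: "nat \<Rightarrow> nat"
  show "det (mat m m (\<lambda>(i, j). stirling_ratio k (a (i + 1) + a (j + 1)))) \<ge> 0"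
    using det_stirling_ratio_nonneg[of m "\<lambda>_. 1" k "\<lambda>i. a (i + 1)"] by simp
  show "det (mat m m (\<lambda>(i, j). (- 1) ^ (a (i + 1) + a (j + 1))
      * stirling_ratio k (a (i + 1) + a (j + 1)))) \<ge> 0"
    using det_stirling_ratio_nonneg[of m "\<lambda>i. (- 1) ^ a (i + 1)" k "\<lambda>i. a (i + 1)"]
    by (simp add: power_add)
qed (rule prod_stirling_ratio_majorization)

end
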